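(* Let $T, D \ge 1$ be integers, let $s_0 \in \mathbb{R}^D$, and let $f_1,\dots,f_T : \mathbb{R}^D \to \mathbb{R}^D$ be differentiable. Let $\mathbf{r}$ be the residual function on $\mathbb{R}^{TD}$, $\mathbf{J}$ its Jacobian, and $\mathbf{s}^*$ its unique zero. For $\mathbf{s} = \operatorname{vec}(s_1,\dots,s_T)$ let $J_t = J_t(\mathbf{s}) = \frac{\partial f_t}{\partial s_{t-1}}(s_{t-1})$, $2 \le t \le T$, and assume that there are constants $\lambda \in \mathbb{R}$, $a \ge 1$, $0 < b \le 1$ such that $$ b\, e^{\lambda k} \ \le\ \| J_{t+k-1} J_{t+k-2} \cdots J_t \|_2 \ \le\ a\, e^{\lambda k} $$ for all $t > 1$, all $k \ge 0$ with $t+k-1 \le T$, and all $\mathbf{s} \in \mathbb{R}^{TD}$ (for $k=0$ the product is the identity). Let $\mathbf{s}^{(0)} \in \mathbb{R}^{TD}$ be arbitrary and let the DEER (Gauss–Newton) iterates be $$ \mathbf{s}^{(i+1)} = \mathbf{s}^{(i)} - \mathbf{J}(\mathbf{s}^{(i)})^{-1} \mathbf{r}(\mathbf{s}^{(i)}), \qquad i \ge 0. $$ Let $\mathbf{e}^{(i)} := \mathbf{s}^{(i)} - \mathbf{s}^*$. Then the error converges to zero at a linear rate: there exist a constant $\chi_w \ge 1$ independent of $i$ and a rate $0 < \beta < 1$ such that for all $i \ge 0$, $$ \| \mathbf{e}^{(i)} \|_2 \ \le\ \chi_w \, \beta^i \, \| \mathbf{e}^{(0)} \|_2 . $$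
   Context: Consider the nonlinear state space model $s_t = f_t(s_{t-1}) \in \mathbb{R}^D$, $t=1,\dots,T$, with fixed initial condition $s_0$. The residual function is $$\mathbf{r}(\mathbf{s}) = \operatorname{vec}\big([s_1 - f_1(s_0), \ldots, s_T - f_T(s_{T-1})]\big) \in \mathbb{R}^{TD}, \qquad \mathbf{s} = \operatorname{vec}(s_1,\dots,s_T) \in \mathbb{R}^{TD},$$ where $\operatorname{vec}$ stacks vectors into one column; its unique zero $\mathbf{s}^*$ is the true trajectory of the model started from $s_0$. Its Jacobian $\mathbf{J}(\mathbf{s}) = \frac{\partial \mathbf{r}}{\partial \mathbf{s}}(\mathbf{s})$ is block bidiagonal with $D\times D$ blocks: its diagonal blocks are $I_D$, its block in block-row $t$ and block-column $t-1$ is $-J_t$ for $t=2,\dots,T$, and all other blocks are zero; in particular it is invertible. $\|\cdot\|_2$ is the Euclidean norm of vectors and the spectral norm of matrices. The number $\lambda$ plays the role of the Largest Lyapunov Exponent of the model, and the displayed two-sided bound is the paper's LLE regularity condition. *)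

theory Defs
  imports "HOL-Analysis.Analysis"
begin

text \<open>
  The horizon is \<open>T = CARD('t)\<close> for a finite linearly ordered type \<open>'t\<close>, the state dimension is
  \<open>D = CARD('d)\<close>, and \<open>\<real>\<^sup>T\<^sup>D\<close> is \<open>real ^ ('t \<times> 'd)\<close>. The increasing bijection \<open>time_of\<close> identifies
  \<open>'t\<close> with the set of times \<open>{1..T}\<close>, and \<open>slot\<close> is its inverse.
\<close>

definition time_of :: "'t::{finite,linorder} \<Rightarrow> nat" where
  "time_of p = card {..p}"

definition slot :: "nat \<Rightarrow> 't::{finite,linorder}" where
  "slot = inv_into UNIV time_of"

definition stack :: "(nat \<Rightarrow> real ^ 'd) \<Rightarrow> real ^ ('t::{finite,linorder} \<times> 'd::finite)" where
  "stack x = (\<chi> k. x (time_of (fst k)) $ snd k)"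

text \<open>
  \<open>state s0 s t\<close> is the block \<open>s\<^sub>t\<close> of \<open>s = vec(s\<^sub>1,\<dots>,s\<^sub>T)\<close>, with the initial condition at \<open>t = 0\<close>;
  it is only meaningful for \<open>t \<le> T\<close>.
\<close>

definition state :: "real ^ 'd \<Rightarrow> real ^ ('t::{finite,linorder} \<times> 'd::finite) \<Rightarrow> nat \<Rightarrow> real ^ 'd" where
  "state s0 s t = (if t = 0 then s0 else (\<chi> i. s $ (slot t, i)))"

definition residual ::
    "(nat \<Rightarrow> real ^ 'd \<Rightarrow> real ^ 'd) \<Rightarrow> real ^ 'd \<Rightarrow>
     real ^ ('t::{finite,linorder} \<times> 'd::finite) \<Rightarrow> real ^ ('t \<times> 'd)" where
  "residual f s0 s = stack (\<lambda>t. state s0 s t - f t (state s0 s (t - 1)))"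

definition residual_jacobian ::
    "(nat \<Rightarrow> real ^ 'd \<Rightarrow> real ^ 'd) \<Rightarrow> real ^ 'd \<Rightarrow>
     real ^ ('t::{finite,linorder} \<times> 'd::finite) \<Rightarrow> real ^ ('t \<times> 'd) ^ ('t \<times> 'd)" where
  "residual_jacobian f s0 s = jacobian (residual f s0) (at s)"

text \<open>Well-defined by \<open>residual_unique_zero\<close> below.\<close>

definition true_trajectory ::
    "(nat \<Rightarrow> real ^ 'd \<Rightarrow> real ^ 'd) \<Rightarrow> real ^ 'd \<Rightarrow>
     real ^ ('t::{finite,linorder} \<times> 'd::finite)" where
  "true_trajectory f s0 = (THE s. residual f s0 s = 0)"

definition step_jacobian ::
    "(nat \<Rightarrow> real ^ 'd \<Rightarrow> real ^ 'd) \<Rightarrow> real ^ 'd \<Rightarrow>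
     real ^ ('t::{finite,linorder} \<times> 'd::finite) \<Rightarrow> nat \<Rightarrow> real ^ 'd ^ 'd" where
  "step_jacobian f s0 s t = jacobian (f t) (at (state s0 s (t - 1)))"

text \<open>\<open>jacobian_product A t k\<close> is \<open>A (t+k-1) ** \<dots> ** A (t+1) ** A t\<close>.\<close>

primrec jacobian_product :: "(nat \<Rightarrow> real ^ 'd ^ 'd) \<Rightarrow> nat \<Rightarrow> nat \<Rightarrow> real ^ 'd ^ 'd::finite" where
  "jacobian_product A t 0 = mat 1"
| "jacobian_product A t (Suc k) = A (t + k) ** jacobian_product A t k"

text \<open>The operator norm induced by the Euclidean norm.\<close>

definition spectral_norm :: "real ^ 'n ^ 'm \<Rightarrow> real" where
  "spectral_norm A = onorm (\<lambda>x. A *v x)"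

lemma strict_mono_time_of: "strict_mono (time_of :: 't::{finite,linorder} \<Rightarrow> nat)"
  unfolding strict_mono_def time_of_def
  by (auto intro!: psubset_card_mono)

lemma time_of_range: "time_of (p :: 't::{finite,linorder}) \<in> {1..CARD('t)}"
proof -
  have "card {..p} \<le> CARD('t)"
    by (rule card_mono) simp_all
  moreover have "card {..p} > 0"
    by (auto simp: card_gt_0_iff)
  ultimately show ?thesis
    by (simp add: time_of_def)
qed

lemma bij_betw_time_of: "bij_betw (time_of :: 't::{finite,linorder} \<Rightarrow> nat) UNIV {1..CARD('t)}"
proof -
  have inj: "inj (time_of :: 't \<Rightarrow> nat)"
    by (rule strict_mono_imp_inj_on[OF strict_mono_time_of])
  have "range (time_of :: 't \<Rightarrow> nat) \<subseteq> {1..CARD('t)}"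
    using time_of_range[where 't='t] by auto
  moreover have "card (range (time_of :: 't \<Rightarrow> nat)) = card {1..CARD('t)}"
    using inj by (simp add: card_image)
  ultimately have "range (time_of :: 't \<Rightarrow> nat) = {1..CARD('t)}"
    by (intro card_subset_eq) auto
  with inj show ?thesis by (simp add: bij_betw_def)
qed

lemma slot_time_of [simp]: "slot (time_of p) = p"
  unfolding slot_def
  by (rule inv_into_f_f[OF strict_mono_imp_inj_on[OF strict_mono_time_of]]) simp

lemma time_of_slot: "t \<in> {1..CARD('t)} \<Longrightarrow> time_of (slot t :: 't::{finite,linorder}) = t"
  unfolding slot_def by (rule f_inv_into_f) (use bij_betw_time_of in \<open>auto simp: bij_betw_def\<close>)

lemma state_stack:
  "t \<in> {1..CARD('t)} \<Longrightarrow> state s0 (stack x :: real ^ ('t::{finite,linorder} \<times> 'd::finite)) t = x t"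
  by (simp add: state_def stack_def time_of_slot vec_eq_iff)

lemma stack_state: "stack (state s0 s) = (s :: real ^ ('t::{finite,linorder} \<times> 'd::finite))"
proof -
  have "state s0 s (time_of p) $ i = s $ (p, i)" for p i
    using time_of_range[of p] by (simp add: state_def)
  then show ?thesis
    by (simp add: stack_def vec_eq_iff)
qed

lemma stack_eq_0_iff:
  "(stack x :: real ^ ('t::{finite,linorder} \<times> 'd::finite)) = 0 \<longleftrightarrow> (\<forall>t\<in>{1..CARD('t)}. x t = 0)"
proof
  assume *: "(stack x :: real ^ ('t \<times> 'd)) = 0"
  show "\<forall>t\<in>{1..CARD('t)}. x t = 0"
  proof
    fix t assume "t \<in> {1..CARD('t)}"
    then have "x t = state 0 (stack x :: real ^ ('t \<times> 'd)) t"
      by (simp add: state_stack)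
    then show "x t = 0"
      by (simp add: * state_def vec_eq_iff)
  qed
next
  assume *: "\<forall>t\<in>{1..CARD('t)}. x t = 0"
  with time_of_range[where 't='t] show "(stack x :: real ^ ('t \<times> 'd)) = 0"
    by (auto simp: stack_def vec_eq_iff)
qed

lemma residual_eq_0_iff:
  fixes s :: "real ^ ('t::{finite,linorder} \<times> 'd::finite)"
  shows "residual f s0 s = 0 \<longleftrightarrow>
    (\<forall>t\<in>{1..CARD('t)}. state s0 s t = f t (state s0 s (t - 1)))"
  by (simp add: residual_def stack_eq_0_iff)

lemma residual_unique_zero:
  "\<exists>!s :: real ^ ('t::{finite,linorder} \<times> 'd::finite). residual f s0 s = 0"
proof -
  define x where "x = rec_nat s0 (\<lambda>t. f (Suc t))"
  have st: "state s0 (stack x :: real ^ ('t \<times> 'd)) t = x t" if "t \<le> CARD('t)" for t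
    using that by (cases "t = 0") (simp_all add: state_def[of _ _ 0] x_def state_stack)
  show ?thesis
  proof (rule ex1I[of _ "stack x"])
    have "x t = f t (x (t - 1))" if "t \<ge> 1" for t
      using that by (cases t) (simp_all add: x_def)
    then have "state s0 (stack x :: real ^ ('t \<times> 'd)) t = f t (state s0 (stack x :: real ^ ('t \<times> 'd)) (t - 1))"
      if "t \<in> {1..CARD('t)}" for t
      using that st[of t] st[of "t - 1"] by auto
    then show "residual f s0 (stack x :: real ^ ('t \<times> 'd)) = 0"
      unfolding residual_eq_0_iff by blast
  next
    fix s :: "real ^ ('t \<times> 'd)"
    assume "residual f s0 s = 0"
    then have *: "state s0 s t = f t (state s0 s (t - 1))" if "t \<in> {1..CARD('t)}" for t
      using that by (simp add: residual_eq_0_iff)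
    have "t \<le> CARD('t) \<Longrightarrow> state s0 s t = x t" for t
    proof (induction t)
      case 0
      show ?case by (simp add: state_def x_def)
    next
      case (Suc t)
      then show ?case using *[of "Suc t"] by (simp add: x_def)
    qed
    then have "stack (state s0 s) = (stack x :: real ^ ('t \<times> 'd))"
      using time_of_range[where 't='t] by (simp add: stack_def)
    then show "s = stack x" by (simp add: stack_state)
  qed
qed

end

theory Submission
  imports Defs
begin

text \<open>
  Write \<open>e\<^sub>t\<close> and \<open>e'\<^sub>t\<close> for the blocks of the error before and after one Gauss--Newton step. Since
  the Jacobian of the residual is block bidiagonal, the Newton equation can be read off block by
  block: the new iterate solves the time-varying \<^emph>\<open>linear\<close> recursion
  \<open>s'\<^sub>t = f\<^sub>t(s\<^sub>t\<^sub>-\<^sub>1) + J\<^sub>t (s'\<^sub>t\<^sub>-\<^sub>1 - s\<^sub>t\<^sub>-\<^sub>1)\<close>, with the exact initial condition. Subtracting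
  \<open>s\<^sup>*\<^sub>t = f\<^sub>t(s\<^sup>*\<^sub>t\<^sub>-\<^sub>1)\<close> gives
  \<open>e'\<^sub>t = f\<^sub>t(s\<^sub>t\<^sub>-\<^sub>1) - f\<^sub>t(s\<^sup>*\<^sub>t\<^sub>-\<^sub>1) - J\<^sub>t e\<^sub>t\<^sub>-\<^sub>1 + J\<^sub>t e'\<^sub>t\<^sub>-\<^sub>1\<close>.

  The upper Lyapunov bound for products of a single factor says that \<open>\<parallel>J\<^sub>t\<parallel> \<le> L = a e\<^sup>\<lambda>\<close> for \<open>t \<ge> 2\<close>,
  everywhere in state space. By the mean value inequality \<open>f\<^sub>t\<close> is then \<open>L\<close>-Lipschitz, whence
  \<open>\<parallel>e'\<^sub>t\<parallel> \<le> L (2 \<parallel>e\<^sub>t\<^sub>-\<^sub>1\<parallel> + \<parallel>e'\<^sub>t\<^sub>-\<^sub>1\<parallel>)\<close> (\<open>newton_step_error_block\<close>); at \<open>t = 1\<close> the error is gone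
  after one step.

  The crucial point is that the error at time \<open>t\<close> is controlled by errors at the
  \<^emph>\<open>strictly earlier\<close> time \<open>t - 1\<close> only. In the weighted norm \<open>\<Sum>\<^sub>t w\<^sup>t \<parallel>e\<^sub>t\<parallel>\<close> each shift in time
  therefore costs one factor \<open>w\<close>, and \<open>L\<close> is replaced by \<open>w L\<close>, as small as desired. With
  \<open>w L \<le> 1/4\<close> one step contracts this norm by \<open>2/3\<close> (\<open>shifted_recursion_contracts\<close>), however large
  \<open>L\<close> is. Returning to the Euclidean norm costs the condition number \<open>T w\<^sup>-\<^sup>T\<close> of the change of norms
  (\<open>weighted_norm_le\<close>, \<open>norm_le_weighted_norm\<close>), once and for all iterations; this is \<open>\<chi>\<^sub>w\<close>.
\<close>

section \<open>Blocks and the weighted norm\<close>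

lemma state_0: "state s0 s 0 = s0"
  by (simp add: state_def)

lemma state_diff:
  "state 0 (x - y) t = state s0 x t - state s0 y t"
  by (simp add: state_def vec_eq_iff)

lemma norm_eq_L2_set_blocks:
  fixes s :: "real ^ ('t::{finite,linorder} \<times> 'd::finite)"
  shows "norm s = L2_set (\<lambda>t. norm (state 0 s t)) {1..CARD('t)}"
proof -
  have block: "(norm (state 0 s (time_of p)))\<^sup>2 = (\<Sum>i\<in>UNIV. (s $ (p, i))\<^sup>2)" for p
    using time_of_range[of p]
    by (simp add: state_def norm_vec_def L2_set_def sum_nonneg)
  have "(\<Sum>k\<in>UNIV. (s $ k)\<^sup>2) = (\<Sum>p\<in>UNIV. \<Sum>i\<in>UNIV. (s $ (p, i))\<^sup>2)"
    by (simp add: sum.cartesian_product)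
  also have "\<dots> = (\<Sum>t\<in>{1..CARD('t)}. (norm (state 0 s t))\<^sup>2)"
    unfolding block[symmetric] by (rule sum.reindex_bij_betw[OF bij_betw_time_of])
  finally show ?thesis
    by (simp add: norm_vec_def L2_set_def)
qed

definition weighted_norm :: "real \<Rightarrow> real ^ ('t::{finite,linorder} \<times> 'd::finite) \<Rightarrow> real" where
  "weighted_norm w s = (\<Sum>t\<le>CARD('t). w ^ t * norm (state 0 s t))"

lemma weighted_norm_eq_sum_from_1:
  fixes s :: "real ^ ('t::{finite,linorder} \<times> 'd::finite)"
  shows "weighted_norm w s = (\<Sum>t\<in>{1..CARD('t)}. w ^ t * norm (state 0 s t))"
  unfolding weighted_norm_def
  by (rule sum.mono_neutral_right) (auto simp: state_0 Suc_le_eq)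

lemma weighted_norm_le:
  fixes s :: "real ^ ('t::{finite,linorder} \<times> 'd::finite)"
  assumes "0 \<le> w" "w \<le> 1"
  shows "weighted_norm w s \<le> real CARD('t) * norm s"
proof -
  have "w ^ t * norm (state 0 s t) \<le> norm s" if "t \<in> {1..CARD('t)}" for t
  proof -
    have "w ^ t * norm (state 0 s t) \<le> 1 * norm (state 0 s t)"
      by (intro mult_right_mono) (use assms in \<open>auto intro: power_le_one\<close>)
    also have "\<dots> \<le> L2_set (\<lambda>t. norm (state 0 s t)) {1..CARD('t)}"
      using member_le_L2_set[OF _ that] by simp
    also have "\<dots> = norm s"
      by (rule norm_eq_L2_set_blocks[symmetric])
    finally show ?thesis .
  qed
  then have "weighted_norm w s \<le> (\<Sum>t\<in>{1..CARD('t)}. norm s)"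
    unfolding weighted_norm_eq_sum_from_1 by (rule sum_mono)
  then show ?thesis
    by simp
qed

lemma norm_le_weighted_norm:
  fixes s :: "real ^ ('t::{finite,linorder} \<times> 'd::finite)"
  assumes "0 \<le> w" "w \<le> 1"
  shows "w ^ CARD('t) * norm s \<le> weighted_norm w s"
proof -
  have "norm s \<le> (\<Sum>t\<in>{1..CARD('t)}. norm (state 0 s t))"
    unfolding norm_eq_L2_set_blocks by (rule L2_set_le_sum) simp
  then have "w ^ CARD('t) * norm s \<le> w ^ CARD('t) * (\<Sum>t\<in>{1..CARD('t)}. norm (state 0 s t))"
    by (intro mult_left_mono) (use assms in auto)
  also have "\<dots> = (\<Sum>t\<in>{1..CARD('t)}. w ^ CARD('t) * norm (state 0 s t))"
    by (rule sum_distrib_left)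
  also have "\<dots> \<le> weighted_norm w s"
    unfolding weighted_norm_eq_sum_from_1
    by (intro sum_mono mult_right_mono power_decreasing) (use assms in auto)
  finally show ?thesis .
qed

text \<open>
  Multiplying the recursion by \<open>w\<^sup>t\<^sup>+\<^sup>1\<close> and summing gives \<open>V \<le> w L (2 U + V) \<le> U / 2 + V / 4\<close> for the
  weighted sums \<open>U\<close> and \<open>V\<close>, and \<open>V\<close> can be absorbed on the left.
\<close>

lemma shifted_recursion_contracts:
  fixes u v :: "nat \<Rightarrow> real"
  assumes nonneg: "\<And>t. 0 \<le> u t" "\<And>t. 0 \<le> v t"
    and start: "v 0 = 0"
    and step: "\<And>t. t < n \<Longrightarrow> v (Suc t) \<le> L * (2 * u t + v t)"
    and w: "0 \<le> w" "w * L \<le> 1 / 4"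
  shows "(\<Sum>t\<le>n. w ^ t * v t) \<le> 2 / 3 * (\<Sum>t\<le>n. w ^ t * u t)"
proof -
  let ?U = "\<Sum>t\<le>n. w ^ t * u t" and ?V = "\<Sum>t\<le>n. w ^ t * v t"
  have "?V = (\<Sum>t<n. w ^ Suc t * v (Suc t))"
    by (simp add: sum.atMost_shift start)
  also have "\<dots> \<le> (\<Sum>t<n. w ^ t * (2 * u t + v t) / 4)"
  proof (rule sum_mono)
    fix t assume "t \<in> {..<n}"
    then have "w ^ Suc t * v (Suc t) \<le> w ^ Suc t * (L * (2 * u t + v t))"
      by (intro mult_left_mono step) (use w in auto)
    also have "\<dots> = (w * L) * (w ^ t * (2 * u t + v t))"
      by (simp add: algebra_simps)
    also have "\<dots> \<le> 1 / 4 * (w ^ t * (2 * u t + v t))"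
      by (intro mult_right_mono) (use w nonneg in auto)
    finally show "w ^ Suc t * v (Suc t) \<le> w ^ t * (2 * u t + v t) / 4"
      by simp
  qed
  also have "\<dots> \<le> (\<Sum>t\<le>n. w ^ t * (2 * u t + v t) / 4)"
    by (rule sum_mono2) (use w nonneg in auto)
  also have "\<dots> = ?U / 2 + ?V / 4"
    by (simp add: sum.distrib sum_divide_distrib algebra_simps add_divide_distrib sum_distrib_left)
  finally show ?thesis
    by simp
qed

section \<open>The Newton equation\<close>

lemma linear_state: "linear (\<lambda>h. state 0 h t)"
  by (rule linearI) (simp_all add: state_def vec_eq_iff)

lemma has_derivative_state:
  fixes s :: "real ^ ('t::{finite,linorder} \<times> 'd::finite)"
  shows "((\<lambda>s. state s0 s t) has_derivative (\<lambda>h. state 0 h t)) (at s)"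
proof -
  have "(\<lambda>s. state s0 s t) = (\<lambda>s :: real ^ ('t \<times> 'd). state 0 s t + (if t = 0 then s0 else 0))"
    by (auto simp: state_def vec_eq_iff)
  moreover have "((\<lambda>s. state 0 s t + (if t = 0 then s0 else 0)) has_derivative (\<lambda>h. state 0 h t)) (at s)"
    by (rule has_derivative_add_const[OF linear_imp_has_derivative[OF linear_state]])
  ultimately show ?thesis
    by (simp only:)
qed

text \<open>
  This is the block bidiagonal form of the Jacobian, written as its action on blocks. For \<open>t = 1\<close> the
  subtracted term is \<open>0\<close>: \<open>f\<^sub>1\<close> is evaluated at the constant initial condition, whose variation
  \<open>state 0 h 0\<close> vanishes.
\<close>

lemma residual_has_derivative:
  fixes s :: "real ^ ('t::{finite,linorder} \<times> 'd::finite)"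
  assumes diff: "\<And>t x. t \<in> {1..CARD('t)} \<Longrightarrow> f t differentiable (at x)"
  shows "(residual f s0 has_derivative
     (\<lambda>h. stack (\<lambda>t. state 0 h t - step_jacobian f s0 s t *v state 0 h (t - 1)))) (at s)"
proof -
  have coordinate: "((\<lambda>z. (state s0 z t - f t (state s0 z (t - 1))) $ j) has_derivative
      (\<lambda>h. (state 0 h t - step_jacobian f s0 s t *v state 0 h (t - 1)) $ j)) (at s)"
    if "t \<in> {1..CARD('t)}" for t j
  proof -
    have "(f t has_derivative (\<lambda>h. step_jacobian f s0 s t *v h)) (at (state s0 s (t - 1)))"
      using diff[OF that] unfolding step_jacobian_def jacobian_works .
    from diff_chain_at[OF has_derivative_state this]
    have "((\<lambda>z. f t (state s0 z (t - 1))) has_derivative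
        (\<lambda>h. step_jacobian f s0 s t *v state 0 h (t - 1))) (at s)"
      by (simp add: o_def)
    from has_derivative_diff[OF has_derivative_state this] show ?thesis
      by (rule bounded_linear.has_derivative[OF bounded_linear_vec_nth])
  qed
  show ?thesis
  proof (rule iffD2[OF has_derivative_componentwise_within], rule ballI)
    fix b :: "real ^ ('t \<times> 'd)"
    assume "b \<in> Basis"
    then obtain k where "b = axis k 1"
      using axis_inverse by blast
    then obtain p j where b: "b = axis (p, j) 1"
      by (cases k) blast
    show "((\<lambda>z. residual f s0 z \<bullet> b) has_derivative
        (\<lambda>h. stack (\<lambda>t. state 0 h t - step_jacobian f s0 s t *v state 0 h (t - 1)) \<bullet> b)) (at s)"
      using coordinate[OF time_of_range, of p j]
      by (simp only: b inner_axis residual_def stack_def vec_lambda_beta fst_conv snd_conv inner_real_def mult_1_right)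
  qed
qed

lemma state_residual_jacobian:
  fixes s h :: "real ^ ('t::{finite,linorder} \<times> 'd::finite)"
  assumes diff: "\<And>t x. t \<in> {1..CARD('t)} \<Longrightarrow> f t differentiable (at x)"
    and t: "t \<in> {1..CARD('t)}"
  shows "state 0 (residual_jacobian f s0 s *v h) t =
    state 0 h t - step_jacobian f s0 s t *v state 0 h (t - 1)"
proof -
  let ?J = "\<lambda>h. stack (\<lambda>t. state 0 h t - step_jacobian f s0 s t *v state 0 h (t - 1)) :: real ^ ('t \<times> 'd)"
  have deriv: "(residual f s0 has_derivative ?J) (at s)"
    by (rule residual_has_derivative[OF diff])
  then have "residual_jacobian f s0 s *v h = ?J h"
    unfolding residual_jacobian_def jacobian_def frechet_derivative_at[OF deriv, symmetric]
    by (simp add: matrix_works has_derivative_linear)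
  then show ?thesis
    using t by (simp add: state_stack)
qed

text \<open>
  A vector in the kernel solves a homogeneous recursion started from \<open>0\<close>.
\<close>

lemma invertible_residual_jacobian:
  fixes s :: "real ^ ('t::{finite,linorder} \<times> 'd::finite)"
  assumes diff: "\<And>t x. t \<in> {1..CARD('t)} \<Longrightarrow> f t differentiable (at x)"
  shows "invertible (residual_jacobian f s0 s)"
proof -
  have "h = 0" if kernel: "residual_jacobian f s0 s *v h = 0" for h
  proof -
    have zero: "state 0 h t = 0" if "t \<le> CARD('t)" for t
      using that
    proof (induction t)
      case 0
      show ?case by (rule state_0)
    next
      case (Suc t)
      have "state 0 h (Suc t) = state 0 (residual_jacobian f s0 s *v h) (Suc t)"
        using state_residual_jacobian[OF diff, where t = "Suc t" and s = s and h = h and ?s0.0 = s0] Suc by simp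
      also have "\<dots> = 0"
        unfolding kernel by (rule linear_0[OF linear_state])
      finally show ?case .
    qed
    have "stack (state 0 h) = (0 :: real ^ ('t \<times> 'd))"
      unfolding stack_eq_0_iff using zero by simp
    then show "h = 0"
      by (simp add: stack_state)
  qed
  then show ?thesis
    by (simp add: invertible_left_inverse matrix_left_invertible_ker)
qed

lemma matrix_inv_right:
  fixes A :: "'a::semiring_1 ^ 'n ^ 'm"
  assumes "invertible A"
  shows "A ** matrix_inv A = mat 1"
  using someI_ex[OF assms[unfolded invertible_def]] unfolding matrix_inv_def by blast

lemma newton_step_state:
  fixes s s' :: "real ^ ('t::{finite,linorder} \<times> 'd::finite)"
  assumes diff: "\<And>t x. t \<in> {1..CARD('t)} \<Longrightarrow> f t differentiable (at x)"
    and newton: "s' = s - matrix_inv (residual_jacobian f s0 s) *v residual f s0 s"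
    and t: "Suc t \<le> CARD('t)"
  shows "state s0 s' (Suc t) =
    f (Suc t) (state s0 s t) + step_jacobian f s0 s (Suc t) *v (state s0 s' t - state s0 s t)"
proof -
  let ?J = "residual_jacobian f s0 s"
  have "?J ** matrix_inv ?J = mat 1"
    by (intro matrix_inv_right invertible_residual_jacobian diff)
  then have "?J *v (s' - s) = - residual f s0 s"
    by (simp add: newton linear_neg[OF matrix_vector_mul_linear] matrix_vector_mul_assoc)
  then have "state 0 (?J *v (s' - s)) (Suc t) = - state 0 (residual f s0 s) (Suc t)"
    by (simp add: linear_neg[OF linear_state])
  moreover have "state 0 (residual f s0 s) (Suc t) = state s0 s (Suc t) - f (Suc t) (state s0 s t)"
    using t by (simp add: residual_def state_stack)
  moreover have "state 0 (?J *v (s' - s)) (Suc t) = state s0 s' (Suc t) - state s0 s (Suc t) -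
      step_jacobian f s0 s (Suc t) *v (state s0 s' t - state s0 s t)"
    using state_residual_jacobian[OF diff, where t = "Suc t" and s = s and h = "s' - s" and ?s0.0 = s0] t
    by (simp add: state_diff[where ?s0.0 = s0])
  ultimately have "state s0 s' (Suc t) - state s0 s (Suc t) -
      step_jacobian f s0 s (Suc t) *v (state s0 s' t - state s0 s t) =
      - (state s0 s (Suc t) - f (Suc t) (state s0 s t))"
    by metis
  then show ?thesis
    by (simp add: algebra_simps)
qed

lemma state_true_trajectory:
  assumes "Suc t \<le> CARD('t)"
  shows "state s0 (true_trajectory f s0 :: real ^ ('t::{finite,linorder} \<times> 'd::finite)) (Suc t) =
    f (Suc t) (state s0 (true_trajectory f s0 :: real ^ ('t \<times> 'd)) t)"
proof -
  have "residual f s0 (true_trajectory f s0 :: real ^ ('t \<times> 'd)) = 0"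
    unfolding true_trajectory_def by (rule theI'[OF residual_unique_zero])
  then show ?thesis
    using assms by (auto simp: residual_eq_0_iff dest: bspec[of _ _ "Suc t"])
qed

section \<open>Contraction of the error\<close>

text \<open>
  A bound on all Jacobians of \<open>f\<^sub>t\<close> is also a Lipschitz constant. It is only available for \<open>t \<ge> 2\<close>; at
  \<open>t = 1\<close> the inequality holds because both sides vanish, the initial condition being exact.
\<close>

lemma newton_step_error_block:
  fixes s s' :: "real ^ ('t::{finite,linorder} \<times> 'd::finite)"
  assumes diff: "\<And>t x. t \<in> {1..CARD('t)} \<Longrightarrow> f t differentiable (at x)"
    and bound: "\<And>t x. 1 < t \<Longrightarrow> t \<le> CARD('t) \<Longrightarrow> onorm (\<lambda>h. jacobian (f t) (at x) *v h) \<le> L"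
    and newton: "s' = s - matrix_inv (residual_jacobian f s0 s) *v residual f s0 s"
    and t: "Suc t \<le> CARD('t)"
  defines "e \<equiv> s - true_trajectory f s0" and "e' \<equiv> s' - true_trajectory f s0"
  shows "norm (state 0 e' (Suc t)) \<le> L * (2 * norm (state 0 e t) + norm (state 0 e' t))"
proof -
  let ?x = "state s0 s t"
  let ?y = "state s0 (true_trajectory f s0 :: real ^ ('t \<times> 'd)) t"
  let ?J = "step_jacobian f s0 s (Suc t)"
  have e: "state 0 e t = state s0 s t - state s0 (true_trajectory f s0 :: real ^ ('t \<times> 'd)) t"
    and e': "state 0 e' t = state s0 s' t - state s0 (true_trajectory f s0 :: real ^ ('t \<times> 'd)) t" for t
    by (simp_all add: e_def e'_def state_diff[where ?s0.0 = s0])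
  have recursion: "state 0 e' (Suc t) =
      (f (Suc t) ?x - f (Suc t) ?y) - ?J *v state 0 e t + ?J *v state 0 e' t"
  proof -
    have "state s0 s' (Suc t) = f (Suc t) ?x + ?J *v (state s0 s' t - ?x)"
      by (intro newton_step_state diff newton t)
    then show ?thesis
      unfolding e e' by (simp add: state_true_trajectory[OF t] matrix_vector_mult_diff_distrib)
  qed
  show ?thesis
  proof (cases "t = 0")
    case True
    then show ?thesis
      unfolding recursion by (simp add: state_0)
  next
    case False
    have Jx: "onorm (\<lambda>h. jacobian (f (Suc t)) (at x) *v h) \<le> L" for x
      using bound[of "Suc t"] False t by simp
    have J: "norm (?J *v h) \<le> L * norm h" for h
    proof -
      have "norm (?J *v h) \<le> onorm (\<lambda>h. ?J *v h) * norm h"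
        by (rule onorm) (rule matrix_vector_mul_bounded_linear)
      also have "\<dots> \<le> L * norm h"
        unfolding step_jacobian_def by (intro mult_right_mono Jx) simp
      finally show ?thesis .
    qed
    have "(f (Suc t) has_derivative (\<lambda>h. jacobian (f (Suc t)) (at x) *v h)) (at x)" for x
      using diff[of "Suc t"] t unfolding jacobian_works by simp
    then have lipschitz: "norm (f (Suc t) ?x - f (Suc t) ?y) \<le> L * norm (?x - ?y)"
      by (intro differentiable_bound[where S = UNIV and f' = "\<lambda>x h. jacobian (f (Suc t)) (at x) *v h"])
        (auto intro: Jx)
    have "norm (state 0 e' (Suc t)) \<le>
        norm (f (Suc t) ?x - f (Suc t) ?y) + norm (?J *v state 0 e t) + norm (?J *v state 0 e' t)"
      unfolding recursion by norm
    also have "\<dots> \<le> L * norm (state 0 e t) + L * norm (state 0 e t) + L * norm (state 0 e' t)"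
      using lipschitz by (intro add_mono J) (simp add: e)
    finally show ?thesis
      by (simp add: algebra_simps)
  qed
qed

theorem theorem4:
  fixes f :: "nat \<Rightarrow> real ^ 'd \<Rightarrow> real ^ 'd"
    and s0 :: "real ^ 'd"
    and lam a b :: real
    and s :: "nat \<Rightarrow> real ^ ('t::{finite,linorder} \<times> 'd::finite)"
  assumes f_differentiable: "\<And>t x. t \<in> {1..CARD('t)} \<Longrightarrow> f t differentiable (at x)"
    and a: "a \<ge> 1"
    and b: "0 < b" "b \<le> 1"
    and lle: "\<And>t k (z :: real ^ ('t \<times> 'd)). t > 1 \<Longrightarrow> t + k - 1 \<le> CARD('t) \<Longrightarrow>
        b * exp (lam * real k) \<le> spectral_norm (jacobian_product (step_jacobian f s0 z) t k) \<and>
        spectral_norm (jacobian_product (step_jacobian f s0 z) t k) \<le> a * exp (lam * real k)"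
    and deer: "\<And>i. s (Suc i) = s i - matrix_inv (residual_jacobian f s0 (s i)) *v residual f s0 (s i)"
  shows "\<exists>chi beta :: real. chi \<ge> 1 \<and> 0 < beta \<and> beta < 1 \<and>
    (\<forall>i. norm (s i - true_trajectory f s0) \<le> chi * beta ^ i * norm (s 0 - true_trajectory f s0))"
proof -
  define L where "L = a * exp lam"
  have L: "0 \<le> L"
    using a by (simp add: L_def)
  have bound: "onorm (\<lambda>h. jacobian (f t) (at x) *v h) \<le> L" if "1 < t" "t \<le> CARD('t)" for t x
  proof -
    \<comment> \<open>A point of \<open>\<real>\<^sup>T\<^sup>D\<close> whose block at time \<open>t - 1\<close> is the given state; this needs \<open>t > 1\<close>.\<close>
    define z where "z = (stack (\<lambda>_. x) :: real ^ ('t \<times> 'd))"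
    have "state s0 z (t - 1) = x"
      unfolding z_def using that by (intro state_stack) auto
    then show ?thesis
      using lle[of t 1 z] that by (simp add: spectral_norm_def step_jacobian_def L_def)
  qed

  \<comment> \<open>Any \<open>0 < w \<le> 1\<close> with \<open>w L \<le> 1/4\<close> works; \<open>L + 1\<close> avoids dividing by \<open>0\<close> and keeps \<open>w\<close> below \<open>1\<close>.\<close>
  define w where "w = 1 / (4 * (L + 1))"
  have w: "0 < w" "w \<le> 1" "w * L \<le> 1 / 4"
    using L by (simp_all add: w_def field_simps)
  let ?e = "\<lambda>i. s i - true_trajectory f s0"
  have "weighted_norm w (?e (Suc i)) \<le> 2 / 3 * weighted_norm w (?e i)" for i
    unfolding weighted_norm_def
    by (rule shifted_recursion_contracts[where L = L])
      (use w newton_step_error_block[OF f_differentiable bound deer[of i]] in \<open>simp_all add: state_0\<close>)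
  then have decay: "weighted_norm w (?e i) \<le> (2 / 3) ^ i * weighted_norm w (?e 0)" for i
  proof (induction i)
    case (Suc i)
    from Suc.prems[of i] Suc.IH[OF Suc.prems] show ?case by simp
  qed simp

  define chi where "chi = real CARD('t) / w ^ CARD('t)"
  have "w ^ CARD('t) \<le> 1"
    using w by (simp add: power_le_one)
  also have "1 \<le> real CARD('t)"
    by (simp add: Suc_le_eq)
  finally have "1 \<le> chi"
    using w by (simp add: chi_def)
  moreover have "norm (?e i) \<le> chi * (2 / 3) ^ i * norm (?e 0)" for i
  proof -
    have "w ^ CARD('t) * norm (?e i) \<le> weighted_norm w (?e i)"
      using w by (intro norm_le_weighted_norm) auto
    also note decay
    also have "(2 / 3) ^ i * weighted_norm w (?e 0) \<le> (2 / 3) ^ i * (real CARD('t) * norm (?e 0))"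
      using w by (intro mult_left_mono weighted_norm_le) auto
    finally show ?thesis
      using w by (simp add: chi_def field_simps)
  qed
  ultimately show ?thesis
    by (intro exI[of _ chi] exI[of _ "2 / 3"]) auto
qed

end
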